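(* Let $R$ be a commutative ring, let $n\in\mathbb{N}$, and let $A=(a_{i,j})_{i,j\in[n]}$ be an $n\times n$-matrix over $R$. Let $J(A)$ be the ideal of $R$ generated by all the differences $\det A_S-\prod_{i\in S}a_{i,i}$, where $S$ ranges over all subsets of $[n]$. Then the $A$-weight of every nontrivial cycle on $[n]$ is integral over $J(A)$. Equivalently, every nontrivial cycle $C$ on $[n]$ satisfies $w_A(C)\in\overline{J(A)}$.
   Context: All rings are commutative, associative and unital; $\mathbb{N}=\{0,1,2,\ldots\}$ and $[n]:=\{1,2,\ldots,n\}$. For $S\subseteq[n]$, $A_S$ denotes the principal submatrix of $A$ with row and column set $S$; the empty determinant is $1$. A cycle on a set $S$ is a $k$-tuple $C=(i_1,i_2,\ldots,i_k)$ with $k>0$ and $i_1,\ldots,i_k$ distinct elements of $S$, considered up to cyclic rotation; its length is $k$, and it is nontrivial if $k>1$. The $A$-weight of a cycle $C=(i_1,\ldots,i_k)$ on $[n]$ is $w_A(C):=a_{i_1,i_2}a_{i_2,i_3}\cdots a_{i_{k-1},i_k}a_{i_k,i_1}$. For an ideal $I$ of $R$, an element $x\in R$ is integral over $I$ if there exist a positive integer $d$ and elements $c_j\in I^j$ for all $j\in[d]$ such that $x^d+c_1x^{d-1}+c_2x^{d-2}+\cdots+c_d=0$. The integral closure $\overline{I}$ is the set of all elements of $R$ integral over $I$. *)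

theory Defs
  imports "HOL-Algebra.Ideal_Product" "HOL-Combinatorics.Permutations"
begin

text \<open>
  Rings are the carrier-based commutative rings of the locale \<^locale>\<open>cring\<close>, so that the zero
  ring is included (the type class \<^class>\<open>comm_ring_1\<close> would exclude it).
  A square matrix with rows and columns indexed by a finite set \<open>S\<close> is a function of two indices,
  of which only the values on \<open>S \<times> S\<close> matter. In particular the principal submatrix of an
  \<open>n \<times> n\<close> matrix \<open>A\<close> with row and column set \<open>S \<subseteq> {1..n}\<close> is \<open>A\<close> itself, read on \<open>S \<times> S\<close>.
\<close>

text \<open>Leibniz formula for the determinant of the \<open>S \<times> S\<close> matrix \<open>A\<close>. The scalar multiple is by the
  integer \<open>sign p\<close>. Value \<open>\<one>\<close> for \<open>S = {}\<close>, see \<open>minor_empty\<close> below.\<close>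

definition principal_minor ::
    "('a, 'b) ring_scheme \<Rightarrow> (nat \<Rightarrow> nat \<Rightarrow> 'a) \<Rightarrow> nat set \<Rightarrow> 'a" where
  "principal_minor R A S =
     (\<Oplus>\<^bsub>R\<^esub>p\<in>{p. p permutes S}. [sign p] \<cdot>\<^bsub>R\<^esub> (\<Otimes>\<^bsub>R\<^esub>i\<in>S. A i (p i)))"

definition minor_ideal ::
    "('a, 'b) ring_scheme \<Rightarrow> nat \<Rightarrow> (nat \<Rightarrow> nat \<Rightarrow> 'a) \<Rightarrow> 'a set" where
  "minor_ideal R n A =
     Idl\<^bsub>R\<^esub> {principal_minor R A S \<ominus>\<^bsub>R\<^esub> (\<Otimes>\<^bsub>R\<^esub>i\<in>S. A i i) | S. S \<subseteq> {1..n}}"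

text \<open>A cycle is represented by any one of the tuples in its rotation class; the weight does not
  depend on the choice (\<open>cycle_weight_rotate\<close> below).\<close>

definition is_cycle_on :: "nat set \<Rightarrow> nat list \<Rightarrow> bool" where
  "is_cycle_on S C \<longleftrightarrow> length C > 0 \<and> distinct C \<and> set C \<subseteq> S"

definition nontrivial_cycle_on :: "nat set \<Rightarrow> nat list \<Rightarrow> bool" where
  "nontrivial_cycle_on S C \<longleftrightarrow> is_cycle_on S C \<and> length C > 1"

definition cycle_weight ::
    "('a, 'b) ring_scheme \<Rightarrow> (nat \<Rightarrow> nat \<Rightarrow> 'a) \<Rightarrow> nat list \<Rightarrow> 'a" where
  "cycle_weight R A C =
     (\<Otimes>\<^bsub>R\<^esub>j\<in>{..<length C}. A (C ! j) (C ! (Suc j mod length C)))"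

text \<open>Powers of the ideal \<open>I\<close> are taken in the semiring \<^const>\<open>ideals_set\<close> of ideals of \<open>R\<close>, whose
  multiplication is the product of ideals.\<close>

definition integral_over_ideal :: "('a, 'b) ring_scheme \<Rightarrow> 'a set \<Rightarrow> 'a \<Rightarrow> bool" where
  "integral_over_ideal R I x \<longleftrightarrow> x \<in> carrier R \<and>
     (\<exists>(d::nat) > 0. \<exists>c. (\<forall>j\<in>{1..d}. c j \<in> I [^]\<^bsub>ideals_set R\<^esub> j) \<and>
        x [^]\<^bsub>R\<^esub> d \<oplus>\<^bsub>R\<^esub> (\<Oplus>\<^bsub>R\<^esub>j\<in>{1..d}. c j \<otimes>\<^bsub>R\<^esub> x [^]\<^bsub>R\<^esub> (d - j)) = \<zero>\<^bsub>R\<^esub>)"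

definition integral_closure :: "('a, 'b) ring_scheme \<Rightarrow> 'a set \<Rightarrow> 'a set" where
  "integral_closure R I = {x. integral_over_ideal R I x}"

lemma (in cring) minor_empty: "principal_minor R A {} = \<one>"
proof -
  have "{p. p permutes ({}::nat set)} = {id}"
    by auto
  moreover have "[(1::int)] \<cdot> \<one> = \<one>"
    by (simp add: add_pow_def int_pow_def nat_pow_def)
  ultimately show ?thesis
    by (simp add: principal_minor_def)
qed

lemma (in cring) minor_singleton:
  assumes "A i i \<in> carrier R"
  shows "principal_minor R A {i} = A i i"
proof -
  have "{p. p permutes {i}} = {id}"
    by auto
  moreover have "[(1::int)] \<cdot> A i i = A i i"
    using assms by (simp add: add_pow_def int_pow_def nat_pow_def)
  ultimately show ?thesis
    using assms by (simp add: principal_minor_def)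
qed

lemma (in cring) cycle_weight_rotate1:
  assumes "\<And>i j. i \<in> set C \<Longrightarrow> j \<in> set C \<Longrightarrow> A i j \<in> carrier R"
  shows "cycle_weight R A (rotate1 C) = cycle_weight R A C"
proof (cases "C = []")
  case False
  define k where "k = length C"
  have k: "k > 0" using False by (simp add: k_def)
  define s where "s = (\<lambda>j. Suc j mod k)"
  define f where "f = (\<lambda>j. A (C ! j) (C ! (Suc j mod k)))"
  have fin: "f \<in> {..<k} \<rightarrow> carrier R"
    using k assms by (auto simp: f_def k_def)
  have surj: "{..<k} \<subseteq> s ` {..<k}"
  proof
    fix j assume "j \<in> {..<k}"
    then show "j \<in> s ` {..<k}"
      by (intro image_eqI[of _ _ "if j = 0 then k - 1 else j - 1"]) (auto simp: s_def)
  qed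
  have img: "s ` {..<k} = {..<k}"
    using surj k by (auto simp: s_def)
  have inj: "inj_on s {..<k}"
    by (rule eq_card_imp_inj_on) (simp_all add: img)
  have "cycle_weight R A (rotate1 C) = (\<Otimes>j\<in>{..<k}. f (s j))"
    unfolding cycle_weight_def length_rotate1 k_def[symmetric]
  proof (rule finprod_cong')
    show "(\<lambda>j. f (s j)) \<in> {..<k} \<rightarrow> carrier R"
      using fin k by (auto simp: s_def)
    show "A (rotate1 C ! j) (rotate1 C ! (Suc j mod k)) = f (s j)" if "j \<in> {..<k}" for j
      using that k by (simp add: f_def s_def nth_rotate1 k_def)
  qed simp
  also have "\<dots> = (\<Otimes>j\<in>s ` {..<k}. f j)"
    by (rule finprod_reindex[symmetric]) (use fin inj img in auto)
  finally show ?thesis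
    unfolding img by (simp add: cycle_weight_def f_def k_def)
qed simp

lemma (in cring) cycle_weight_rotate:
  assumes "\<And>i j. i \<in> set C \<Longrightarrow> j \<in> set C \<Longrightarrow> A i j \<in> carrier R"
  shows "cycle_weight R A (rotate m C) = cycle_weight R A C"
proof (induction m)
  case (Suc m)
  have "cycle_weight R A (rotate1 (rotate m C)) = cycle_weight R A (rotate m C)"
    by (rule cycle_weight_rotate1) (use assms in auto)
  then show ?case
    using Suc by simp
qed simp

end

theory Submission
  imports Defs "HOL-Combinatorics.Orbits" "HOL-Combinatorics.Cycles"
begin

text \<open>
  Write \<open>J\<close> for the ideal generated by the differences between principal minors and diagonal
  products. The proof adjoins the cycle weights to \<open>J\<close> one support at a time, smaller supports first.
  Let \<open>L\<close> contain \<open>J\<close> and the weights of all nontrivial cycles supported on proper subsets of \<open>S\<close>, and let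
  \<open>L'\<close> be \<open>L\<close> together with the weights of the cycles with support exactly \<open>S\<close>. Then \<open>L' \<cdot> L' \<subseteq> L \<cdot> L'\<close>,
  which rests on two observations (\<open>cycle_products_mem\<close>).

  First, let \<open>p \<noteq> q\<close> be two transitive permutations of \<open>S\<close>, and let \<open>p u \<noteq> q u\<close>. Going from \<open>u\<close> to \<open>q u\<close>
  and then along \<open>p\<close> back to \<open>u\<close> gives a cycle that misses \<open>p u\<close>; exchanging \<open>p\<close> and \<open>q\<close> gives another
  one, which uses other arcs. Hence \<open>w(p) w(q)\<close> is divisible by a product of two weights of smaller
  cycles and lies in \<open>L \<cdot> L\<close> (\<open>cyclic_perm_weight_prod\<close>).

  Second, the minor on \<open>S\<close> minus the diagonal product is the signed sum of the weights of all
  permutations other than the identity. Multiply this element of \<open>J\<close> by \<open>w(p)\<close>: the permutations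
  that are not transitive have weights in \<open>L\<close> (\<open>noncyclic_perm_weight\<close>), the other transitive ones
  are covered by the first observation, and what remains is \<open>w(p)\<^sup>2\<close> up to sign. So \<open>w(p)\<^sup>2 \<in> L \<cdot> L'\<close>
  (\<open>perm_weight_square_mem\<close>).

  Chaining these steps over all supports shows that \<open>J\<close> is a reduction of the ideal \<open>L\<close> generated by
  \<open>J\<close> and all nontrivial cycle weights: \<open>L\<^sup>m\<^sup>+\<^sup>1 \<subseteq> J \<cdot> L\<^sup>m\<close> for some \<open>m\<close> (\<open>minor_ideal_reduction\<close>). Since \<open>L\<close> is
  finitely generated, every element of \<open>L\<close> is then integral over \<open>J\<close> (\<open>integral_of_reduction\<close>). The
  usual argument for this takes a determinant over the generators of \<open>L\<^sup>m\<close>; here the generators are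
  eliminated one after the other instead (\<open>monic_annihilator\<close>).
\<close>

section \<open>Ideals, their products and powers\<close>

context cring
begin

lemma ideal_mem:
  assumes "ideal K R"
  shows "x \<in> K \<Longrightarrow> x \<in> carrier R"
    and "\<zero> \<in> K"
    and "x \<in> K \<Longrightarrow> y \<in> K \<Longrightarrow> x \<oplus> y \<in> K"
    and "x \<in> K \<Longrightarrow> \<ominus> x \<in> K"
    and "x \<in> K \<Longrightarrow> y \<in> K \<Longrightarrow> x \<ominus> y \<in> K"
    and "r \<in> carrier R \<Longrightarrow> x \<in> K \<Longrightarrow> r \<otimes> x \<in> K"
    and "r \<in> carrier R \<Longrightarrow> x \<in> K \<Longrightarrow> x \<otimes> r \<in> K"
proof -
  interpret K: ideal K R by fact
  show "x \<in> K \<Longrightarrow> x \<in> carrier R" by (rule K.Icarr)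
  show "\<zero> \<in> K" by (rule K.zero_closed)
  show "x \<in> K \<Longrightarrow> y \<in> K \<Longrightarrow> x \<oplus> y \<in> K" for x y by (rule K.a_closed)
  show m: "x \<in> K \<Longrightarrow> \<ominus> x \<in> K" for x by (rule K.a_inv_closed)
  show "x \<in> K \<Longrightarrow> y \<in> K \<Longrightarrow> x \<ominus> y \<in> K"
    unfolding a_minus_def by (intro K.a_closed m)
  show "r \<in> carrier R \<Longrightarrow> x \<in> K \<Longrightarrow> r \<otimes> x \<in> K" by (rule K.I_l_closed)
  show "r \<in> carrier R \<Longrightarrow> x \<in> K \<Longrightarrow> x \<otimes> r \<in> K" by (rule K.I_r_closed)
qed

lemma finsum_in_ideal:
  assumes "ideal K R" "\<And>i. i \<in> X \<Longrightarrow> f i \<in> K"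
  shows "(\<Oplus>i\<in>X. f i) \<in> K"
  using assms(2)
proof (induction X rule: infinite_finite_induct)
  case (insert x X)
  have "f \<in> X \<rightarrow> carrier R" "f x \<in> carrier R"
    using insert.prems ideal_mem(1)[OF assms(1)] by auto
  then show ?case
    using insert ideal_mem(3)[OF assms(1)] by simp
qed (use ideal_mem(2)[OF assms(1)] in auto)

lemma ideal_prod_subsetI:
  assumes "ideal K R" "\<And>x y. x \<in> I \<Longrightarrow> y \<in> J \<Longrightarrow> x \<otimes> y \<in> K"
  shows "I \<cdot> J \<subseteq> K"
proof
  fix z assume "z \<in> I \<cdot> J"
  then show "z \<in> K"
    by induction (use assms ideal_mem(3)[OF assms(1)] in auto)
qed

lemma ideal_prod_mono:
  assumes "I \<subseteq> I'" "J \<subseteq> J'"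
  shows "I \<cdot> J \<subseteq> I' \<cdot> J'"
proof
  fix z assume "z \<in> I \<cdot> J"
  then show "z \<in> I' \<cdot> J'"
    by induction (use assms in \<open>auto intro: ideal_prod.intros\<close>)
qed

lemma ideal_colon:
  assumes "ideal K R" "y \<in> carrier R"
  shows "ideal {x \<in> carrier R. x \<otimes> y \<in> K} R"
proof (rule idealI)
  show "subgroup {x \<in> carrier R. x \<otimes> y \<in> K} (add_monoid R)"
  proof (rule add.subgroupI)
    show "{x \<in> carrier R. x \<otimes> y \<in> K} \<noteq> {}"
      using assms ideal_mem(2)[OF assms(1)] by (auto intro!: exI[of _ \<zero>])
    fix a b assume a: "a \<in> {x \<in> carrier R. x \<otimes> y \<in> K}" and b: "b \<in> {x \<in> carrier R. x \<otimes> y \<in> K}"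
    show "a \<oplus> b \<in> {x \<in> carrier R. x \<otimes> y \<in> K}"
      using a b assms ideal_mem(3)[OF assms(1)] by (auto simp: l_distr)
  next
    fix a assume a: "a \<in> {x \<in> carrier R. x \<otimes> y \<in> K}"
    then show "\<ominus> a \<in> {x \<in> carrier R. x \<otimes> y \<in> K}"
      using assms ideal_mem(4)[OF assms(1)] by (auto simp: l_minus)
  qed auto
next
  fix a x assume a: "a \<in> {x \<in> carrier R. x \<otimes> y \<in> K}" and x: "x \<in> carrier R"
  have "x \<otimes> (a \<otimes> y) \<in> K"
    using a x ideal_mem(6)[OF assms(1)] by simp
  then have "x \<otimes> a \<otimes> y \<in> K"
    using a x assms(2) by (simp add: m_assoc)
  then show "x \<otimes> a \<in> {x \<in> carrier R. x \<otimes> y \<in> K}" "a \<otimes> x \<in> {x \<in> carrier R. x \<otimes> y \<in> K}"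
    using a x by (auto simp: m_comm)
qed (rule ring_axioms)

text \<open>Membership in an ideal \<open>K\<close> is linear in each factor, so the colon ideals of the previous lemma
  reduce an inclusion between products of ideals to products of generators, one factor at a time.\<close>

lemma genideal_prod_subsetI:
  assumes "X \<subseteq> carrier R" "Y \<subseteq> carrier R" "ideal K R"
    and "\<And>x y. x \<in> X \<Longrightarrow> y \<in> Y \<Longrightarrow> x \<otimes> y \<in> K"
  shows "(Idl X) \<cdot> (Idl Y) \<subseteq> K"
proof (rule ideal_prod_subsetI[OF assms(3)])
  have *: "a \<otimes> y \<in> K" if "a \<in> Idl X" "y \<in> Y" for a y
  proof -
    have "Idl X \<subseteq> {a \<in> carrier R. a \<otimes> y \<in> K}"
      using assms that by (intro genideal_minimal ideal_colon) auto
    then show ?thesis using that by auto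
  qed
  fix a b assume a: "a \<in> Idl X" and b: "b \<in> Idl Y"
  have aR: "a \<in> carrier R"
    using a ideal_mem(1)[OF genideal_ideal[OF assms(1)]] by blast
  have "y \<otimes> a \<in> K" if "y \<in> Y" for y
    using *[OF a that] aR that assms(2) by (metis m_comm subsetD)
  then have "Idl Y \<subseteq> {b \<in> carrier R. b \<otimes> a \<in> K}"
    using assms aR by (intro genideal_minimal ideal_colon) auto
  then show "a \<otimes> b \<in> K"
    using b aR by (auto simp: m_comm)
qed

lemma genideal_prod_finite:
  assumes "finite X" "finite Y" "X \<subseteq> carrier R" "Y \<subseteq> carrier R"
  shows "\<exists>Z. finite Z \<and> Z \<subseteq> carrier R \<and> (Idl X) \<cdot> (Idl Y) = Idl Z"
proof -
  let ?Z = "(\<lambda>(x, y). x \<otimes> y) ` (X \<times> Y)"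
  have Z: "?Z \<subseteq> carrier R"
    using assms by auto
  have "(Idl X) \<cdot> (Idl Y) \<subseteq> Idl ?Z"
    using assms genideal_self[OF Z] by (intro genideal_prod_subsetI genideal_ideal[OF Z]) auto
  moreover have "Idl ?Z \<subseteq> (Idl X) \<cdot> (Idl Y)"
    using genideal_self[OF assms(3)] genideal_self[OF assms(4)]
    by (intro genideal_minimal ideal_prod_is_ideal genideal_ideal assms)
       (auto intro!: ideal_prod.prod)
  ultimately show ?thesis
    using assms(1,2) Z by (intro exI[of _ ?Z]) auto
qed

text \<open>The same power as in the definition of integrality over an ideal, kept folded so that the
  simplification rules for powers in an arbitrary monoid do not rewrite it.\<close>

definition ideal_pow :: "'a set \<Rightarrow> nat \<Rightarrow> 'a set" where
  "ideal_pow I m = I [^]\<^bsub>ideals_set R\<^esub> m"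

lemma ideal_pow_simps:
  "ideal_pow I 0 = carrier R" "ideal_pow I (Suc m) = ideal_pow I m \<cdot> I"
  by (simp_all add: ideal_pow_def) (simp_all add: ideals_set_def)

lemma ideal_pow_ideal: "ideal I R \<Longrightarrow> ideal (ideal_pow I m) R"
  by (induction m) (auto simp: ideal_pow_simps oneideal ideal_prod_is_ideal)

lemma ideal_pow_1: "ideal I R \<Longrightarrow> ideal_pow I (Suc 0) = I"
  by (simp add: ideal_pow_simps ideal_prod_commute oneideal ideal_prod_one)

lemma ideal_pow_add:
  assumes "ideal I R"
  shows "ideal_pow I (l + m) = ideal_pow I l \<cdot> ideal_pow I m"
proof (induction m)
  case 0
  then show ?case by (simp add: ideal_pow_simps ideal_prod_one ideal_pow_ideal[OF assms])
next
  case (Suc m)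
  then show ?case
    using assms by (simp add: ideal_pow_simps ideal_prod_assoc ideal_pow_ideal)
qed

lemma ideal_pow_mono: "I \<subseteq> J \<Longrightarrow> ideal_pow I m \<subseteq> ideal_pow J m"
  by (induction m) (auto simp: ideal_pow_simps intro: ideal_prod_mono[THEN subsetD])

lemma pow_in_ideal_pow:
  assumes "ideal I R" "u \<in> I"
  shows "u [^] m \<in> ideal_pow I m"
  by (induction m) (use assms in \<open>auto simp: ideal_pow_simps intro: ideal_prod.prod\<close>)

lemma ideal_pow_finite:
  assumes "finite X" "X \<subseteq> carrier R"
  shows "\<exists>Z. finite Z \<and> Z \<subseteq> carrier R \<and> ideal_pow (Idl X) m = Idl Z"
proof (induction m)
  case 0
  then show ?case
    by (intro exI[of _ "{\<one>}"]) (simp add: ideal_pow_simps genideal_one)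
next
  case (Suc m)
  then obtain Z where "finite Z" "Z \<subseteq> carrier R" "ideal_pow (Idl X) m = Idl Z"
    by blast
  then show ?case
    using genideal_prod_finite[of Z X] assms by (simp add: ideal_pow_simps)
qed

lemma set_add_upper:
  assumes "ideal I R" "ideal J R"
  shows "I \<subseteq> I <+>\<^bsub>R\<^esub> J" "J \<subseteq> I <+>\<^bsub>R\<^esub> J"
  using union_genideal[OF assms] genideal_self[of "I \<union> J"] ideal_mem(1)[OF assms(1)]
    ideal_mem(1)[OF assms(2)] by blast+

section \<open>Elimination without determinants\<close>

lemma ideal_prod_insertE:
  assumes "ideal F R" "g \<in> carrier R" "G \<subseteq> carrier R" "x \<in> F \<cdot> (Idl (insert g G))"
  obtains f w where "f \<in> F" "w \<in> F \<cdot> (Idl G)" "x = f \<otimes> g \<oplus> w"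
proof -
  have V: "ideal (Idl G) R"
    using assms by (intro genideal_ideal)
  have FV: "ideal (F \<cdot> (Idl G)) R"
    using assms V by (intro ideal_prod_is_ideal)
  have sub: "Idl (insert g G) \<subseteq> PIdl g <+>\<^bsub>R\<^esub> Idl G"
  proof (rule genideal_minimal)
    show "ideal (PIdl g <+>\<^bsub>R\<^esub> Idl G) R"
      by (intro add_ideals cgenideal_ideal V assms)
    have "PIdl g \<union> Idl G \<subseteq> PIdl g <+>\<^bsub>R\<^esub> Idl G"
      using set_add_upper[OF cgenideal_ideal[OF assms(2)] V] by blast
    then show "insert g G \<subseteq> PIdl g <+>\<^bsub>R\<^esub> Idl G"
      using genideal_self[OF assms(3)] cgenideal_self[OF assms(2)] by blast
  qed
  have "\<exists>f\<in>F. \<exists>w\<in>F \<cdot> (Idl G). x = f \<otimes> g \<oplus> w"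
    using assms(4)
  proof induction
    case (prod i j)
    then obtain r v where rv: "r \<in> carrier R" "v \<in> Idl G" "j = r \<otimes> g \<oplus> v"
      using sub by (force simp: set_add_def' cgenideal_def)
    have "i \<otimes> j = (i \<otimes> r) \<otimes> g \<oplus> i \<otimes> v"
      using rv prod ideal_mem(1)[OF V] ideal_mem(1)[OF assms(1)] assms(2)
      by (simp add: r_distr m_assoc)
    then show ?case
      using rv prod ideal_mem(7)[OF assms(1)] by (blast intro: ideal_prod.prod)
  next
    case (sum s t)
    then obtain f w f' w' where *: "f \<in> F" "w \<in> F \<cdot> (Idl G)" "s = f \<otimes> g \<oplus> w"
        "f' \<in> F" "w' \<in> F \<cdot> (Idl G)" "t = f' \<otimes> g \<oplus> w'"
      by blast
    then have "s \<oplus> t = (f \<oplus> f') \<otimes> g \<oplus> (w \<oplus> w')"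
      using ideal_mem(1)[OF FV] ideal_mem(1)[OF assms(1)] assms(2)
      by (simp add: l_distr a_ac)
    then show ?case
      using * ideal_mem(3)[OF FV] ideal_mem(3)[OF assms(1)] by blast
  qed
  then show ?thesis using that by blast
qed

lemma add_minus_cancel:
  assumes "x \<in> carrier R" "y \<in> carrier R"
  shows "(x \<oplus> y) \<ominus> x = y"
  using assms by (simp add: a_minus_def a_comm[of x y] a_assoc r_neg)

text \<open>The grading bookkeeping of the elimination: if \<open>K\<close> has weight one, elements of \<open>J \<cdot> K\<^sup>e\<close> have
  weight \<open>e + 1\<close>, and weights add up under multiplication.\<close>

lemma mult_homogeneous_mem:
  assumes "ideal J R" "ideal K R" "ideal V R"
    and "a \<in> ideal_pow K (Suc d)" "w \<in> (J \<cdot> ideal_pow K e) \<cdot> V"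
  shows "a \<otimes> w \<in> (J \<cdot> ideal_pow K (Suc (d + e))) \<cdot> V"
proof -
  note I = assms(1-3) ideal_pow_ideal[OF assms(2)] ideal_prod_is_ideal
  have "a \<otimes> w \<in> ideal_pow K (Suc d) \<cdot> ((J \<cdot> ideal_pow K e) \<cdot> V)"
    using assms by (intro ideal_prod.prod)
  also have "ideal_pow K (Suc d) \<cdot> ((J \<cdot> ideal_pow K e) \<cdot> V)
      = (ideal_pow K (Suc d) \<cdot> J \<cdot> ideal_pow K e) \<cdot> V"
    by (simp add: ideal_prod_assoc I)
  also have "ideal_pow K (Suc d) \<cdot> J = J \<cdot> ideal_pow K (Suc d)"
    by (intro ideal_prod_commute I)
  also have "J \<cdot> ideal_pow K (Suc d) \<cdot> ideal_pow K e = J \<cdot> ideal_pow K (Suc d + e)"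
    using ideal_pow_add[OF assms(2), of "Suc d" e] by (simp add: ideal_prod_assoc I)
  finally show ?thesis by simp
qed

text \<open>This replaces the Cayley--Hamilton theorem. Call \<open>u\<^sup>e\<^sup>+\<^sup>1 - f\<close> with \<open>f \<in> J \<cdot> K\<^sup>e\<close> monic; such elements
  are closed under products. If \<open>u\<^sup>d\<^sup>+\<^sup>1\<close> maps a finitely generated ideal into \<open>J \<cdot> K\<^sup>d\<close> times itself,
  then the relation for one generator \<open>g0\<close> reads \<open>e \<otimes> g0 = w\<close> with \<open>e\<close> monic and \<open>w\<close> in the span of the
  other generators. Multiplying the relations for the others by \<open>e\<close> eliminates \<open>g0\<close> from them, at the
  price of doubling the degree. The monic annihilator of the others found by induction,
  multiplied by \<open>e\<close>, then annihilates \<open>g0\<close> as well. The degree \<open>d\<close> has to stay arbitrary in the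
  induction because of the doubling.\<close>

lemma monic_annihilator:
  assumes "ideal J R" "ideal K R" "J \<subseteq> K" "u \<in> K" "finite G" "G \<subseteq> carrier R"
    and "\<And>g. g \<in> G \<Longrightarrow> u [^] Suc d \<otimes> g \<in> (J \<cdot> ideal_pow K d) \<cdot> (Idl G)"
  shows "\<exists>e. \<exists>f \<in> J \<cdot> ideal_pow K e. \<forall>g\<in>G. (u [^] Suc e \<ominus> f) \<otimes> g = \<zero>"
  using assms(5-7)
proof (induction G arbitrary: d rule: finite_induct)
  case empty
  have "\<zero> \<in> J \<cdot> ideal_pow K 0"
    by (intro ideal_mem(2) ideal_prod_is_ideal ideal_pow_ideal assms)
  then show ?case by blast
next
  case (insert g0 G)
  note I = assms(1,2) ideal_pow_ideal[OF assms(2)] ideal_prod_is_ideal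
  define U where "U = u [^] Suc d"
  define F where "F = J \<cdot> ideal_pow K d"
  define V where "V = Idl G"
  have V: "ideal V R" using insert.prems unfolding V_def by (intro genideal_ideal) auto
  have F: "ideal F R" unfolding F_def by (intro I)
  have FV: "ideal (F \<cdot> V) R" by (intro I F V)
  have FK: "F \<subseteq> ideal_pow K (Suc d)"
    unfolding F_def ideal_pow_simps ideal_prod_commute[OF I(3) I(2), of d]
    using assms(3) by (intro ideal_prod_mono) auto
  have UK: "U \<in> ideal_pow K (Suc d)"
    unfolding U_def using assms by (intro pow_in_ideal_pow)
  have split: "\<exists>f\<in>F. \<exists>w\<in>F \<cdot> V. U \<otimes> g = f \<otimes> g0 \<oplus> w" if "g \<in> insert g0 G" for g
    unfolding V_def
    by (rule ideal_prod_insertE[OF F, of g0 G "U \<otimes> g"])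
       (use insert.prems that in \<open>auto simp: U_def F_def\<close>)
  obtain f w where fw: "f \<in> F" "w \<in> F \<cdot> V" "U \<otimes> g0 = f \<otimes> g0 \<oplus> w"
    using split[of g0] by auto
  have c: "u \<in> carrier R" "g0 \<in> carrier R" "U \<in> carrier R" "f \<in> carrier R" "w \<in> carrier R"
    using insert.prems fw ideal_mem(1)[OF assms(2)] assms(4) ideal_mem(1)[OF F]
      ideal_mem(1)[OF FV] by (auto simp: U_def)
  have E: "U \<ominus> f \<in> ideal_pow K (Suc d)"
    using UK FK fw by (intro ideal_mem(5) I) auto
  define e where "e = U \<ominus> f"
  have eR: "e \<in> carrier R" using c by (simp add: e_def)
  have Ufe: "U = f \<oplus> e"
    using c by (simp add: e_def a_minus_def a_lcomm r_neg)
  have "f \<otimes> g0 \<oplus> w = f \<otimes> g0 \<oplus> e \<otimes> g0"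
    using c eR fw(3) Ufe by (metis l_distr)
  then have w: "w = e \<otimes> g0"
    using c eR by simp
  have "u [^] Suc (Suc (d + d)) \<otimes> g \<in> (J \<cdot> ideal_pow K (Suc (d + d))) \<cdot> V" if g: "g \<in> G" for g
  proof -
    obtain f' w' where fw': "f' \<in> F" "w' \<in> F \<cdot> V" "U \<otimes> g = f' \<otimes> g0 \<oplus> w'"
      using split[of g] g by auto
    have c': "f' \<in> carrier R" "w' \<in> carrier R" "g \<in> carrier R"
      using fw' ideal_mem(1)[OF F] ideal_mem(1)[OF FV] insert.prems g by auto
    have "u [^] Suc (Suc (d + d)) = U \<otimes> U"
      using c nat_pow_mult[of u "Suc d" "Suc d"] by (simp add: U_def)
    then have "u [^] Suc (Suc (d + d)) \<otimes> g = U \<otimes> (U \<otimes> g)"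
      using c c' by (simp add: m_assoc)
    also have "\<dots> = f \<otimes> (U \<otimes> g) \<oplus> e \<otimes> (U \<otimes> g)"
      using c c' eR Ufe by (metis l_distr m_closed)
    also have "f \<otimes> (U \<otimes> g) = U \<otimes> (f \<otimes> g)"
      using c c' by (simp add: m_lcomm)
    also have "e \<otimes> (U \<otimes> g) = f' \<otimes> w \<oplus> e \<otimes> w'"
      unfolding fw'(3) w using c c' eR by (simp add: r_distr m_lcomm)
    also have "U \<otimes> (f \<otimes> g) \<oplus> (f' \<otimes> w \<oplus> e \<otimes> w') \<in> (J \<cdot> ideal_pow K (Suc (d + d))) \<cdot> V"
    proof (intro ideal_mem(3))
      have "g \<in> V"
        using g insert.prems genideal_self[of G] by (auto simp: V_def)
      then have "f \<otimes> g \<in> F \<cdot> V"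
        using fw(1) by (intro ideal_prod.prod)
      then show "U \<otimes> (f \<otimes> g) \<in> (J \<cdot> ideal_pow K (Suc (d + d))) \<cdot> V"
        unfolding F_def by (intro mult_homogeneous_mem I V UK)
      show "f' \<otimes> w \<in> (J \<cdot> ideal_pow K (Suc (d + d))) \<cdot> V"
        using fw fw' FK unfolding F_def by (intro mult_homogeneous_mem I V) auto
      show "e \<otimes> w' \<in> (J \<cdot> ideal_pow K (Suc (d + d))) \<cdot> V"
        using fw' E unfolding F_def e_def by (intro mult_homogeneous_mem I V) auto
    qed (intro I V)+
    finally show ?thesis .
  qed
  then obtain k h where h: "h \<in> J \<cdot> ideal_pow K k" "\<forall>g\<in>G. (u [^] Suc k \<ominus> h) \<otimes> g = \<zero>"
    using insert.IH[of "Suc (d + d)"] insert.prems unfolding V_def by auto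
  define U' where "U' = u [^] Suc k"
  have hR: "h \<in> carrier R"
    using h by (intro ideal_mem(1)[OF _ h(1)] I)
  have U'R: "U' \<in> carrier R" using c by (simp add: U'_def)
  have R: "ideal (carrier R) R" by (rule oneideal)
  have hV: "(U' \<ominus> h) \<otimes> v = \<zero>" if "v \<in> V" for v
  proof -
    have Uh: "U' \<ominus> h \<in> carrier R"
      using hR U'R by simp
    have "g \<otimes> (U' \<ominus> h) = \<zero>" if "g \<in> G" for g
    proof -
      have "g \<in> carrier R" using insert.prems(1) that by blast
      then show ?thesis using h(2) that m_comm[OF _ Uh, of g] unfolding U'_def by metis
    qed
    then have "V \<subseteq> {x \<in> carrier R. x \<otimes> (U' \<ominus> h) \<in> {\<zero>}}"
      unfolding V_def using insert.prems(1) Uh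
      by (intro genideal_minimal ideal_colon zeroideal) auto
    then show ?thesis using that hR U'R by (auto simp: m_comm)
  qed
  have wV: "w \<in> V"
    using fw(2) ideal_prod_inter[OF F V] by auto
  define h' where "h' = U' \<ominus> h"
  have h'R: "h' \<in> carrier R" using hR U'R by (simp add: h'_def)
  have U'h: "U' = h \<oplus> h'"
    using hR U'R by (simp add: h'_def a_minus_def a_lcomm r_neg)
  \<comment> \<open>\<open>f1\<close> is chosen to make the product of the two monic elements \<open>U' - h\<close> and \<open>U - f\<close> monic again\<close>
  define f1 where "f1 = U \<otimes> h \<oplus> (U' \<ominus> h) \<otimes> f"
  have eq: "u [^] Suc (Suc (d + k)) \<ominus> f1 = (U' \<ominus> h) \<otimes> e"
  proof -
    have "u [^] Suc (Suc (d + k)) = U \<otimes> U'"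
      using c nat_pow_mult[of u "Suc d" "Suc k"] by (simp add: U_def U'_def)
    also have "\<dots> = U \<otimes> h \<oplus> U \<otimes> h'"
      using c hR U'h h'R by (metis r_distr)
    also have "U \<otimes> h' = h' \<otimes> f \<oplus> h' \<otimes> e"
      unfolding Ufe using c eR h'R by (simp add: r_distr m_comm[of "f \<oplus> e" h'])
    finally have "u [^] Suc (Suc (d + k)) = f1 \<oplus> h' \<otimes> e"
      unfolding f1_def h'_def[symmetric] using c eR h'R hR by (simp only: a_assoc m_closed)
    moreover have "f1 \<in> carrier R"
      unfolding f1_def h'_def[symmetric] using c h'R hR by simp
    ultimately show ?thesis
      unfolding h'_def[symmetric] using eR h'R by (simp only: add_minus_cancel m_closed)
  qed
  have "f1 \<in> J \<cdot> ideal_pow K (Suc (d + k))"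
  proof -
    have "U \<otimes> h \<in> (J \<cdot> ideal_pow K (Suc (d + k))) \<cdot> carrier R"
      using h by (intro mult_homogeneous_mem I R UK) (simp add: ideal_prod_one I)
    moreover have "U' \<ominus> h \<in> ideal_pow K (Suc k)"
    proof (intro ideal_mem(5) I)
      show "U' \<in> ideal_pow K (Suc k)"
        unfolding U'_def by (intro pow_in_ideal_pow assms)
      show "h \<in> ideal_pow K (Suc k)"
        using h(1) ideal_prod_mono[OF assms(3) order_refl, of "ideal_pow K k"]
        by (auto simp: ideal_pow_simps ideal_prod_commute[OF I(3) I(2)])
    qed
    then have "(U' \<ominus> h) \<otimes> f \<in> (J \<cdot> ideal_pow K (Suc (k + d))) \<cdot> carrier R"
      using fw by (intro mult_homogeneous_mem I R) (simp_all add: ideal_prod_one I F_def)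
    ultimately show ?thesis
      unfolding f1_def by (intro ideal_mem(3)) (simp_all add: ideal_prod_one I add.commute)
  qed
  moreover have "(u [^] Suc (Suc (d + k)) \<ominus> f1) \<otimes> g = \<zero>" if "g \<in> insert g0 G" for g
  proof (cases "g = g0")
    case True
    have "h' \<otimes> (e \<otimes> g0) = \<zero>"
      using hV[OF wV] unfolding w h'_def .
    then have "h' \<otimes> e \<otimes> g0 = \<zero>"
      using m_assoc[OF h'R eR c(2)] by simp
    then show ?thesis
      unfolding eq True h'_def .
  next
    case False
    then have g: "h' \<otimes> g = \<zero>" "g \<in> carrier R"
      using that h insert.prems by (auto simp: U'_def h'_def)
    have "h' \<otimes> e \<otimes> g = e \<otimes> (h' \<otimes> g)"
      using g(2) eR h'R by (metis m_assoc m_comm)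
    then show ?thesis
      unfolding eq g(1) using eR by (simp add: h'_def)
  qed
  ultimately show ?case by blast
qed


section \<open>Integrality from a reduction\<close>

text \<open>Modulo the multiples of \<open>U\<close>, a product of one factor from \<open>J\<close> and \<open>d + 1\<close> factors from \<open>J + U\<close> only
  involves factors from \<open>J\<close>. Iterated for principal \<open>U\<close>, this expands such a product in powers of a
  generator of \<open>U\<close>, with the \<open>j\<close>-th coefficient in \<open>J\<^sup>j\<close>.\<close>

lemma prod_pow_sum_subset:
  assumes "ideal J R" "ideal U R"
  shows "J \<cdot> ideal_pow (J <+>\<^bsub>R\<^esub> U) (Suc d)
    \<subseteq> (J \<cdot> ideal_pow (J <+>\<^bsub>R\<^esub> U) d) \<cdot> U <+>\<^bsub>R\<^esub> ideal_pow J (Suc (Suc d))"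
proof (induction d)
  case 0
  have "ideal (J <+>\<^bsub>R\<^esub> U) R" by (intro add_ideals assms)
  moreover have "J \<cdot> (J <+>\<^bsub>R\<^esub> U) = J \<cdot> U <+>\<^bsub>R\<^esub> J \<cdot> J"
    using ideal_prod_distr(1)[OF assms(1,1,2)] assms set_add_comm[of "J \<cdot> J" "J \<cdot> U"]
      ideal_prod_in_carrier by simp
  ultimately show ?case
    using ideal_pow_1[of J] ideal_pow_1[of "J <+>\<^bsub>R\<^esub> U"] assms
    by (simp add: ideal_pow_simps(2)[of J "Suc 0"]) (simp add: ideal_pow_simps ideal_prod_one)
next
  case (Suc d)
  define K where "K = J <+>\<^bsub>R\<^esub> U"
  have K: "ideal K R" unfolding K_def by (intro add_ideals assms)
  note I = assms K ideal_pow_ideal[OF assms(1)] ideal_pow_ideal[OF K] ideal_prod_is_ideal add_ideals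
  define X where "X = J \<cdot> ideal_pow K d"
  define Y where "Y = J \<cdot> ideal_pow K (Suc d)"
  define T where "T = Y \<cdot> U <+>\<^bsub>R\<^esub> ideal_pow J (Suc (Suc (Suc d)))"
  have X: "ideal X R" and Y: "ideal Y R"
    unfolding X_def Y_def by (intro I)+
  have T: "ideal T R" unfolding T_def by (intro I Y)
  have XY: "Y = X \<cdot> K"
    unfolding X_def Y_def ideal_pow_simps by (simp add: ideal_prod_assoc I)
  have YU: "Y \<cdot> U \<subseteq> T" and JT: "ideal_pow J (Suc (Suc (Suc d))) \<subseteq> T"
    unfolding T_def by (intro set_add_upper I Y)+
  have "X \<cdot> U \<cdot> J = (X \<cdot> J) \<cdot> U"
    by (simp add: ideal_prod_assoc X I ideal_prod_commute[of U J])
  also have "\<dots> \<subseteq> Y \<cdot> U"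
    unfolding XY K_def by (intro ideal_prod_mono order_refl set_add_upper I)
  finally have XUJ: "X \<cdot> U \<cdot> J \<subseteq> T" using YU by blast
  have "Y \<cdot> J \<subseteq> (X \<cdot> U <+>\<^bsub>R\<^esub> ideal_pow J (Suc (Suc d))) \<cdot> J"
    using Suc.IH unfolding X_def Y_def K_def by (intro ideal_prod_mono) auto
  also have "\<dots> = X \<cdot> U \<cdot> J <+>\<^bsub>R\<^esub> ideal_pow J (Suc (Suc (Suc d)))"
    unfolding ideal_pow_simps(2)[of J "Suc (Suc d)"] by (intro ideal_prod_distr I X)
  finally have YJ: "Y \<cdot> J \<subseteq> T"
    using XUJ JT ideal_mem(3)[OF T] by (fastforce simp: set_add_def')
  have "J \<cdot> ideal_pow K (Suc (Suc d)) = Y \<cdot> K"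
    unfolding Y_def ideal_pow_simps(2)[of K "Suc d"] by (simp add: ideal_prod_assoc I)
  also have "\<dots> = Y \<cdot> J <+>\<^bsub>R\<^esub> Y \<cdot> U"
    unfolding K_def by (intro ideal_prod_distr I Y)
  also have "\<dots> \<subseteq> T"
    using YU YJ ideal_mem(3)[OF T] by (fastforce simp: set_add_def')
  finally show ?case
    unfolding T_def Y_def K_def .
qed

lemma prod_pow_expand:
  assumes "ideal J R" "u \<in> carrier R" "f \<in> J \<cdot> ideal_pow (J <+>\<^bsub>R\<^esub> PIdl u) d"
  shows "\<exists>c. (\<forall>j\<in>{1..Suc d}. c j \<in> ideal_pow J j) \<and>
    f = (\<Oplus>j\<in>{1..Suc d}. c j \<otimes> u [^] (Suc d - j))"
  using assms(3)
proof (induction d arbitrary: f)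
  case 0
  then have f: "f \<in> J" by (simp add: ideal_pow_simps ideal_prod_one assms)
  then have "f \<in> carrier R" using ideal_mem(1)[OF assms(1)] by blast
  then show ?case
    using f by (intro exI[of _ "\<lambda>_. f"]) (simp add: ideal_pow_1 assms)
next
  case (Suc d)
  have U: "ideal (PIdl u) R" by (intro cgenideal_ideal assms)
  define X where "X = J \<cdot> ideal_pow (J <+>\<^bsub>R\<^esub> PIdl u) d"
  have X: "ideal X R"
    unfolding X_def by (intro ideal_prod_is_ideal ideal_pow_ideal add_ideals assms U)
  obtain e b where eb: "e \<in> X \<cdot> (PIdl u)" "b \<in> ideal_pow J (Suc (Suc d))" "f = e \<oplus> b"
    using Suc.prems prod_pow_sum_subset[OF assms(1) U, of d] unfolding X_def
    by (force simp: set_add_def')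
  have "\<exists>x\<in>X. e = x \<otimes> u"
    using eb(1)
  proof induction
    case (prod i j)
    then obtain r where "r \<in> carrier R" "j = r \<otimes> u" by (auto simp: cgenideal_def)
    then show ?case
      using prod(1) ideal_mem(1,7)[OF X] assms(2) by (intro bexI[of _ "i \<otimes> r"]) (auto simp: m_assoc)
  next
    case (sum s t)
    then obtain x y where "x \<in> X" "y \<in> X" "s = x \<otimes> u" "t = y \<otimes> u" by blast
    then show ?case
      using ideal_mem(1,3)[OF X] assms(2) by (intro bexI[of _ "x \<oplus> y"]) (auto simp: l_distr)
  qed
  then obtain x where x: "x \<in> X" "e = x \<otimes> u" by blast
  obtain c where c: "\<forall>j\<in>{1..Suc d}. c j \<in> ideal_pow J j"
      "x = (\<Oplus>j\<in>{1..Suc d}. c j \<otimes> u [^] (Suc d - j))"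
    using Suc.IH x unfolding X_def by blast
  define c' where "c' = c(Suc (Suc d) := b)"
  have c'J: "\<forall>j\<in>{1..Suc (Suc d)}. c' j \<in> ideal_pow J j"
    using c(1) eb(2) by (auto simp: c'_def)
  then have c'R: "c' j \<in> carrier R" if "j \<in> {1..Suc (Suc d)}" for j
    using that ideal_mem(1)[OF ideal_pow_ideal[OF assms(1)]] by blast
  have cR: "c j \<in> carrier R" if "j \<in> {1..Suc d}" for j
    using that c ideal_mem(1)[OF ideal_pow_ideal[OF assms(1)]] by blast
  have "e = (\<Oplus>j\<in>{1..Suc d}. c j \<otimes> u [^] (Suc d - j) \<otimes> u)"
    unfolding x(2) c(2) using cR assms(2) by (intro finsum_ldistr) auto
  also have "\<dots> = (\<Oplus>j\<in>{1..Suc d}. c' j \<otimes> u [^] (Suc (Suc d) - j))"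
    using cR assms(2)
    by (intro finsum_cong') (auto simp: c'_def m_assoc Suc_diff_le)
  finally have e: "e = \<dots>" .
  have bR: "b \<in> carrier R"
    using eb(2) ideal_mem(1)[OF ideal_pow_ideal[OF assms(1)]] by blast
  have "(\<Oplus>j\<in>{1..Suc (Suc d)}. c' j \<otimes> u [^] (Suc (Suc d) - j)) = b \<oplus> e"
  proof -
    have set: "{1..Suc (Suc d)} = insert (Suc (Suc d)) {1..Suc d}" by auto
    have "(\<lambda>j. c' j \<otimes> u [^] (Suc (Suc d) - j)) \<in> {1..Suc d} \<rightarrow> carrier R"
      using c'R assms(2) by auto
    moreover have "c' (Suc (Suc d)) = b" by (simp add: c'_def)
    ultimately show ?thesis
      unfolding e set using assms(2) bR by (subst finsum_insert) auto
  qed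
  then show ?case
    using c'J eb(3) x ideal_mem(1)[OF X] assms(2) bR by (intro exI[of _ c']) (simp add: a_comm)
qed

lemma eq_if_mult_minus_eq_zero:
  assumes "x \<in> carrier R" "a \<in> carrier R" "b \<in> carrier R" "x \<otimes> (a \<ominus> b) = \<zero>"
  shows "x \<otimes> a = x \<otimes> b"
proof -
  have "a = (a \<ominus> b) \<oplus> b"
    using assms(2,3) by (simp add: a_minus_def a_assoc l_neg)
  then have "x \<otimes> a = x \<otimes> (a \<ominus> b) \<oplus> x \<otimes> b"
    using assms(1-3) by (metis r_distr minus_closed)
  then show ?thesis using assms by simp
qed

text \<open>For \<open>J \<subseteq> L\<close>, an inclusion \<open>L\<^sup>m\<^sup>+\<^sup>1 \<subseteq> J \<cdot> L\<^sup>m\<close> says that \<open>J\<close> is a reduction of \<open>L\<close>. Given it,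
  multiplication by \<open>u \<in> L\<close> maps the finitely generated ideal \<open>L\<^sup>m\<close> into \<open>J \<cdot> L\<^sup>m\<close>, so a monic element
  \<open>u\<^sup>d\<^sup>+\<^sup>1 - f\<close> annihilates \<open>L\<^sup>m\<close>. It need not vanish itself, but \<open>u\<^sup>m \<in> L\<^sup>m\<close>, so its product with \<open>u\<^sup>m\<close>
  does, and that product is an equation of integral dependence.\<close>

theorem integral_of_reduction:
  assumes "ideal J R" "finite X" "X \<subseteq> carrier R"
    and red: "ideal_pow (Idl X) (Suc m) \<subseteq> J \<cdot> ideal_pow (Idl X) m"
    and u: "u \<in> Idl X"
  shows "integral_over_ideal R J u"
proof -
  have L: "ideal (Idl X) R" by (intro genideal_ideal assms)
  have uR: "u \<in> carrier R" using u ideal_mem(1)[OF L] by blast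
  have U: "ideal (PIdl u) R" by (intro cgenideal_ideal uR)
  define K where "K = J <+>\<^bsub>R\<^esub> PIdl u"
  have K: "ideal K R" unfolding K_def by (intro add_ideals assms U)
  have JK: "J \<subseteq> K" and uK: "u \<in> K"
    using set_add_upper[OF assms(1) U] cgenideal_self[OF uR] by (auto simp: K_def)
  obtain G where G: "finite G" "G \<subseteq> carrier R" "ideal_pow (Idl X) m = Idl G"
    using ideal_pow_finite[OF assms(2,3)] by blast
  have "u [^] Suc 0 \<otimes> g \<in> (J \<cdot> ideal_pow K 0) \<cdot> (Idl G)" if "g \<in> G" for g
  proof -
    have "g \<in> ideal_pow (Idl X) m"
      using that genideal_self[OF G(2)] unfolding G(3) by blast
    then have "g \<otimes> u \<in> J \<cdot> ideal_pow (Idl X) m"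
      using red u by (auto simp: ideal_pow_simps intro: ideal_prod.prod)
    then show ?thesis
      using that G uR by (auto simp: ideal_pow_simps ideal_prod_one assms m_comm)
  qed
  then obtain d f where f: "f \<in> J \<cdot> ideal_pow K d" "\<forall>g\<in>G. (u [^] Suc d \<ominus> f) \<otimes> g = \<zero>"
    using monic_annihilator[OF assms(1) K JK uK G(1,2)] by blast
  have fR: "f \<in> carrier R"
    using f(1) by (intro ideal_mem(1)[OF ideal_prod_is_ideal]) (auto intro: assms ideal_pow_ideal K)
  have uf: "u [^] Suc d \<ominus> f \<in> carrier R"
    using uR fR by simp
  have "g \<otimes> (u [^] Suc d \<ominus> f) = \<zero>" if "g \<in> G" for g
  proof -
    have "g \<in> carrier R" using G(2) that by blast
    then show ?thesis using f(2) that m_comm[OF _ uf, of g] by metis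
  qed
  then have "Idl G \<subseteq> {x \<in> carrier R. x \<otimes> (u [^] Suc d \<ominus> f) \<in> {\<zero>}}"
    using G uf by (intro genideal_minimal ideal_colon zeroideal) auto
  moreover have "u [^] m \<in> Idl G"
    unfolding G(3)[symmetric] by (intro pow_in_ideal_pow L u)
  ultimately have "u [^] m \<otimes> (u [^] Suc d \<ominus> f) = \<zero>"
    by blast
  then have "u [^] m \<otimes> u [^] Suc d = u [^] m \<otimes> f"
    by (rule eq_if_mult_minus_eq_zero[OF nat_pow_closed[OF uR] nat_pow_closed[OF uR] fR])
  then have eq: "u [^] (Suc (d + m)) = u [^] m \<otimes> f"
    unfolding nat_pow_mult[OF uR] by (simp only: add_Suc_right add.commute)
  have "f \<otimes> u [^] m \<in> (J \<cdot> ideal_pow K d) \<cdot> ideal_pow K m"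
    using f(1) by (intro ideal_prod.prod pow_in_ideal_pow K uK)
  then have "u [^] (Suc (d + m)) \<in> J \<cdot> ideal_pow K (d + m)"
    unfolding eq m_comm[OF fR nat_pow_closed[OF uR]] ideal_pow_add[OF K]
    by (simp add: ideal_prod_assoc ideal_pow_ideal K assms)
  then obtain c where c: "\<forall>j\<in>{1..Suc (d + m)}. c j \<in> ideal_pow J j"
      "u [^] (Suc (d + m)) = (\<Oplus>j\<in>{1..Suc (d + m)}. c j \<otimes> u [^] (Suc (d + m) - j))"
    using prod_pow_expand[OF assms(1) uR] unfolding K_def by blast
  have cR: "c j \<in> carrier R" if "j \<in> {1..Suc (d + m)}" for j
    using that c ideal_mem(1)[OF ideal_pow_ideal[OF assms(1)]] by blast
  have "(\<Oplus>j\<in>{1..Suc (d + m)}. (\<ominus> c j) \<otimes> u [^] (Suc (d + m) - j))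
      = (\<Oplus>j\<in>{1..Suc (d + m)}. \<ominus> \<one> \<otimes> (c j \<otimes> u [^] (Suc (d + m) - j)))"
    using cR uR by (intro finsum_cong') (auto simp: l_minus)
  also have "\<dots> = \<ominus> \<one> \<otimes> u [^] (Suc (d + m))"
    unfolding c(2) using cR uR by (intro finsum_rdistr[symmetric]) auto
  finally have "u [^] (Suc (d + m)) \<oplus>
      (\<Oplus>j\<in>{1..Suc (d + m)}. (\<ominus> c j) \<otimes> u [^] (Suc (d + m) - j)) = \<zero>"
    using uR by (simp only: l_minus nat_pow_closed one_closed l_one r_neg)
  moreover have "\<forall>j\<in>{1..Suc (d + m)}. \<ominus> c j \<in> ideal_pow J j"
    using c(1) ideal_mem(4)[OF ideal_pow_ideal[OF assms(1)]] by blast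
  ultimately show ?thesis
    unfolding integral_over_ideal_def ideal_pow_def using uR
    by (intro conjI exI[of _ "Suc (d + m)"] exI[of _ "\<lambda>j. \<ominus> c j"]) auto
qed

text \<open>Being a reduction is transitive. When the second step is given by \<open>L\<^sup>2 \<subseteq> K \<cdot> L\<close>, this is the chain
  \<open>L\<^sup>m\<^sup>+\<^sup>2 \<subseteq> K\<^sup>m\<^sup>+\<^sup>1 \<cdot> L \<subseteq> J \<cdot> K\<^sup>m \<cdot> L \<subseteq> J \<cdot> L\<^sup>m\<^sup>+\<^sup>1\<close>.\<close>

lemma reduction_extend:
  assumes "ideal J R" "ideal K R" "ideal L R" "K \<subseteq> L"
    and JK: "ideal_pow K (Suc m) \<subseteq> J \<cdot> ideal_pow K m"
    and KL: "L \<cdot> L \<subseteq> K \<cdot> L"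
  shows "ideal_pow L (Suc (Suc m)) \<subseteq> J \<cdot> ideal_pow L (Suc m)"
proof -
  note I = assms(1-3) ideal_pow_ideal ideal_prod_is_ideal
  have *: "ideal_pow L (Suc k) \<subseteq> ideal_pow K k \<cdot> L" for k
  proof (induction k)
    case 0
    show ?case by (simp add: ideal_pow_simps)
  next
    case (Suc k)
    have "ideal_pow L (Suc (Suc k)) \<subseteq> ideal_pow K k \<cdot> L \<cdot> L"
      unfolding ideal_pow_simps(2)[of L "Suc k"] by (intro ideal_prod_mono Suc order_refl)
    also have "\<dots> = ideal_pow K k \<cdot> (L \<cdot> L)"
      by (intro ideal_prod_assoc I)
    also have "\<dots> \<subseteq> ideal_pow K k \<cdot> (K \<cdot> L)"
      by (intro ideal_prod_mono KL order_refl)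
    also have "\<dots> = ideal_pow K (Suc k) \<cdot> L"
      unfolding ideal_pow_simps by (intro ideal_prod_assoc[symmetric] I)
    finally show ?case .
  qed
  have "ideal_pow L (Suc (Suc m)) \<subseteq> J \<cdot> ideal_pow K m \<cdot> L"
    using * ideal_prod_mono[OF JK order_refl] by blast
  also have "\<dots> = J \<cdot> (ideal_pow K m \<cdot> L)"
    by (intro ideal_prod_assoc I)
  also have "\<dots> \<subseteq> J \<cdot> ideal_pow L (Suc m)"
    unfolding ideal_pow_simps by (intro ideal_prod_mono ideal_pow_mono order_refl assms)
  finally show ?thesis .
qed

section \<open>Cycles and permutations\<close>

text \<open>The shortest path \<open>x, f x, f (f x), \<dots>, u\<close> visits no point twice, so the single extra arc from \<open>u\<close>
  back to \<open>x\<close> closes it to a cycle. If \<open>f u\<close> already lies on the path, then by injectivity it can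
  only be the starting point; this is what later shows that a cycle misses a point of \<open>S\<close>.\<close>

lemma cycle_closing_orbit_path:
  fixes f :: "nat \<Rightarrow> nat"
  assumes f: "f permutes S" and fin: "finite S" and x: "x \<in> S" and u: "u \<in> orbit f x"
    and A: "\<forall>i\<in>S. \<forall>j\<in>S. A i j \<in> carrier R"
  shows "\<exists>C. is_cycle_on S C \<and> set C \<subseteq> orbit f x \<and> x \<in> set C \<and> u \<in> set C \<and>
    (f u \<in> set C \<longrightarrow> f u = x) \<and>
    cycle_weight R A C = A u x \<otimes> (\<Otimes>y\<in>set C - {u}. A y (f y))"
proof -
  have perm: "permutation f"
    using f fin by (auto simp: permutation_permutes)
  define h where "h = (\<lambda>j. (f ^^ j) x)"
  have hS: "h j \<in> S" for j
    using x permutes_in_image[OF f] by (induction j) (auto simp: h_def)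
  have "\<exists>k. h k = u"
    using u unfolding orbit_altdef h_def by blast
  then obtain k where k: "h k = u" "\<And>j. j < k \<Longrightarrow> h j \<noteq> u"
    using LeastI_ex[of "\<lambda>k. h k = u"] not_less_Least[of _ "\<lambda>k. h k = u"] by metis
  have step: "h (Suc j) = f (h j)" for j by (simp add: h_def)
  have h0: "h 0 = x" by (simp add: h_def)
  have shift: "h i = h j \<Longrightarrow> h (i + m) = h (j + m)" for i j m
    by (induction m) (auto simp: step)
  have inj: "inj_on h {..<Suc k}"
  proof (rule linorder_inj_onI)
    fix i j assume "i < j" "j \<in> {..<Suc k}"
    then show "h i \<noteq> h j"
      using shift[of i j "k - j"] k by auto
  qed auto
  define C where "C = map h [0..<Suc k]"
  have setC: "set C = h ` {..<Suc k}"
    by (auto simp: C_def simp del: upt_Suc)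
  have len: "length C = Suc k" by (simp add: C_def)
  have nth: "C ! j = h j" if "j < Suc k" for j
    using that by (simp add: C_def nth_append del: upt_Suc)
  have img: "h ` {..<k} = set C - {u}"
    using k inj unfolding setC by (auto simp: less_Suc_eq)
  have "distinct C"
    unfolding C_def using inj by (simp add: distinct_map lessThan_atLeast0 del: upt_Suc)
  then have "is_cycle_on S C"
    using hS by (auto simp: is_cycle_on_def setC len)
  moreover have "set C \<subseteq> orbit f x"
    unfolding orbit_altdef_permutation[OF perm] setC h_def by auto
  moreover have "x \<in> set C" "u \<in> set C"
    using h0 k(1) unfolding setC by (metis imageI lessThan_iff zero_less_Suc, auto)
  moreover have "f u = x" if fu: "f u \<in> set C"
  proof -
    obtain j where j: "j < Suc k" "f u = h j"
      using fu setC by auto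
    show ?thesis
    proof (cases j)
      case 0
      then show ?thesis using j h0 by simp
    next
      case (Suc i)
      then have "f u = f (h i)" using j step by simp
      then have "u = h i" using permutes_inj[OF f] by (auto dest: injD)
      then show ?thesis using k(2)[of i] j Suc by simp
    qed
  qed
  moreover have "cycle_weight R A C = A u x \<otimes> (\<Otimes>y\<in>set C - {u}. A y (f y))"
  proof -
    have "cycle_weight R A C = (\<Otimes>j\<in>insert k {..<k}. A (h j) (if j = k then x else h (Suc j)))"
      unfolding cycle_weight_def len
      using A hS x h0 by (intro finprod_cong') (auto simp: nth mod_Suc)
    also have "\<dots> = A u x \<otimes> (\<Otimes>j\<in>{..<k}. A (h j) (if j = k then x else h (Suc j)))"
      using A hS x k by (subst finprod_insert) auto
    also have "(\<Otimes>j\<in>{..<k}. A (h j) (if j = k then x else h (Suc j))) = (\<Otimes>j\<in>{..<k}. A (h j) (f (h j)))"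
      using A hS by (intro finprod_cong') (auto simp: step[symmetric])
    also have "\<dots> = (\<Otimes>y\<in>h ` {..<k}. A y (f y))"
      using A hS inj step by (intro finprod_reindex[symmetric]) (auto simp: step[symmetric] inj_on_def)
    finally show ?thesis unfolding img .
  qed
  ultimately show ?thesis by blast
qed

abbreviation perm_weight :: "(nat \<Rightarrow> nat \<Rightarrow> 'a) \<Rightarrow> nat set \<Rightarrow> (nat \<Rightarrow> nat) \<Rightarrow> 'a" where
  "perm_weight A S p \<equiv> \<Otimes>i\<in>S. A i (p i)"

lemma perm_weight_closed:
  assumes "p permutes S" "T \<subseteq> S" "\<forall>i\<in>S. \<forall>j\<in>S. A i j \<in> carrier R"
  shows "perm_weight A T p \<in> carrier R"
proof (rule finprod_closed, rule Pi_I)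
  fix i assume "i \<in> T"
  then have "i \<in> S" "p i \<in> S"
    using assms(2) permutes_in_image[OF assms(1), of i] by auto
  then show "A i (p i) \<in> carrier R" using assms(3) by blast
qed

lemma perm_weight_split:
  assumes "p permutes S" "finite S" "T \<subseteq> U" "U \<subseteq> S"
    and "\<forall>i\<in>S. \<forall>j\<in>S. A i j \<in> carrier R"
  shows "perm_weight A U p = perm_weight A T p \<otimes> perm_weight A (U - T) p"
proof -
  have U: "T \<union> (U - T) = U" using assms by auto
  have entry: "A i (p i) \<in> carrier R" if "i \<in> U" for i
  proof -
    have "i \<in> S" "p i \<in> S"
      using that assms(4) permutes_in_image[OF assms(1), of i] by auto
    then show ?thesis using assms(5) by blast
  qed
  have "finite U" using assms(2,4) finite_subset by blast
  moreover then have "finite T" using assms(3) finite_subset by blast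
  ultimately have "perm_weight A (T \<union> (U - T)) p = perm_weight A T p \<otimes> perm_weight A (U - T) p"
    using entry assms(3) by (intro finprod_Un_disjoint) auto
  then show ?thesis unfolding U .
qed

lemma nontrivial_cycleI:
  assumes "is_cycle_on S C" "x \<in> set C" "y \<in> set C" "x \<noteq> y"
  shows "nontrivial_cycle_on S C"
proof -
  have "card {x, y} \<le> card (set C)" using assms by (intro card_mono) auto
  also have "\<dots> \<le> length C" by (rule card_length)
  finally show ?thesis using assms by (simp add: nontrivial_cycle_on_def)
qed

text \<open>A permutation that is neither the identity nor transitive on \<open>S\<close> has a nontrivial orbit
  different from \<open>S\<close>, whose cycle weight divides the weight of the permutation.\<close>

lemma noncyclic_perm_weight:
  assumes p: "p permutes S" "p \<noteq> id" "\<not> cyclic_on p S" and fin: "finite S"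
    and A: "\<forall>i\<in>S. \<forall>j\<in>S. A i j \<in> carrier R"
  shows "\<exists>C a. nontrivial_cycle_on S C \<and> set C \<noteq> S \<and> a \<in> carrier R \<and>
    perm_weight A S p = cycle_weight R A C \<otimes> a"
proof -
  obtain x where x: "p x \<noteq> x" using p(2) by (auto simp: fun_eq_iff)
  then have xS: "x \<in> S" using p(1) by (auto simp: permutes_def)
  then have pxS: "p x \<in> S" using permutes_in_image[OF p(1)] by simp
  have perm: "permutation p" using p fin by (auto simp: permutation_permutes)
  have "x \<in> orbit p (p x)"
    using permutation_self_in_orbit[OF perm] permutation_orbit_step[OF perm] by auto
  then obtain C where C: "is_cycle_on S C" "set C \<subseteq> orbit p (p x)" "p x \<in> set C" "x \<in> set C"
      "cycle_weight R A C = A x (p x) \<otimes> perm_weight A (set C - {x}) p"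
    using cycle_closing_orbit_path[OF p(1) fin pxS _ A, of x] by blast
  have CS: "set C \<subseteq> S" using C by (simp add: is_cycle_on_def)
  have "set C \<noteq> S"
  proof
    assume "set C = S"
    then have "S = orbit p (p x)"
      using C(2) permutes_orbit_subset[OF p(1) pxS] by auto
    then show False using p(3) pxS cyclic_on_singleI by metis
  qed
  moreover have "cycle_weight R A C = perm_weight A (set C) p"
    unfolding C(5) using perm_weight_split[OF p(1) fin _ CS A, of "{x}"] C(4) A xS pxS by simp
  then have "perm_weight A S p = cycle_weight R A C \<otimes> perm_weight A (S - set C) p"
    using perm_weight_split[OF p(1) fin CS order_refl A] by simp
  moreover have "perm_weight A (S - set C) p \<in> carrier R"
    using perm_weight_closed[OF p(1) _ A] by simp
  ultimately show ?thesis
    using nontrivial_cycleI[OF C(1,3,4) x] by blast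
qed

text \<open>The arc \<open>u \<rightarrow> q u\<close> followed by the \<open>p\<close>-path from \<open>q u\<close> back to \<open>u\<close> is a cycle. It misses \<open>p u\<close>, so it is
  shorter than \<open>p\<close>, and it uses no \<open>p\<close>-arc leaving \<open>u\<close>.\<close>

lemma shortcut_cycle:
  assumes p: "p permutes S" "cyclic_on p S" and q: "q permutes S" "cyclic_on q S"
    and fin: "finite S" and u: "u \<in> S" "p u \<noteq> q u"
    and A: "\<forall>i\<in>S. \<forall>j\<in>S. A i j \<in> carrier R"
  shows "\<exists>C a. nontrivial_cycle_on S C \<and> set C \<noteq> S \<and> a \<in> carrier R \<and>
    A u (q u) \<otimes> perm_weight A (S - {u}) p = cycle_weight R A C \<otimes> a"
proof -
  have pu: "p u \<in> S" and qu: "q u \<in> S"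
    using u permutes_in_image[OF p(1)] permutes_in_image[OF q(1)] by auto
  have qne: "q u \<noteq> u"
  proof
    assume "q u = u"
    then have "S = {u}" using orbit_cyclic_eq3[OF q(2) u(1)] orbit_eq_singleton_iff[of q u] by blast
    then show False using u(2) pu \<open>q u = u\<close> by simp
  qed
  have "u \<in> orbit p (q u)" using orbit_cyclic_eq3[OF p(2) qu] u by simp
  then obtain C where C: "is_cycle_on S C" "q u \<in> set C" "u \<in> set C" "p u \<in> set C \<Longrightarrow> p u = q u"
      "cycle_weight R A C = A u (q u) \<otimes> perm_weight A (set C - {u}) p"
    using cycle_closing_orbit_path[OF p(1) fin qu _ A, of u] by blast
  have CS: "set C \<subseteq> S" using C by (simp add: is_cycle_on_def)
  have "set C \<noteq> S" using C(4) u(2) pu by auto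
  moreover have "S - {u} - (set C - {u}) = S - set C" using C(3) by auto
  then have "perm_weight A (S - {u}) p = perm_weight A (set C - {u}) p \<otimes> perm_weight A (S - set C) p"
    using perm_weight_split[OF p(1) fin Diff_mono[OF CS order_refl] Diff_subset A, of "{u}"] by simp
  then have "A u (q u) \<otimes> perm_weight A (S - {u}) p = cycle_weight R A C \<otimes> perm_weight A (S - set C) p"
    unfolding C(5) using bspec[OF bspec[OF A u(1)] qu] perm_weight_closed[OF p(1) _ A, of "S - set C"]
      perm_weight_closed[OF p(1) _ A, of "set C - {u}"] CS by (simp add: m_assoc Diff_subset subset_iff)
  moreover have "perm_weight A (S - set C) p \<in> carrier R"
    using perm_weight_closed[OF p(1) _ A] by simp
  ultimately show ?thesis
    using nontrivial_cycleI[OF C(1,2,3) qne] by blast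
qed

text \<open>Choose \<open>u\<close> with \<open>p u \<noteq> q u\<close> and take the two shortcuts at \<open>u\<close>: the arc of \<open>q\<close> completed by arcs of \<open>p\<close>,
  and the arc of \<open>p\<close> completed by arcs of \<open>q\<close>. They use different arcs of the multigraph formed by
  all arcs of \<open>p\<close> and \<open>q\<close>, so the product of their weights divides the product of the weights of \<open>p\<close> and \<open>q\<close>.\<close>

lemma cyclic_perm_weight_prod:
  assumes p: "p permutes S" "cyclic_on p S" and q: "q permutes S" "cyclic_on q S"
    and fin: "finite S" and ne: "p \<noteq> q"
    and A: "\<forall>i\<in>S. \<forall>j\<in>S. A i j \<in> carrier R"
  shows "\<exists>C D a. nontrivial_cycle_on S C \<and> set C \<noteq> S \<and> nontrivial_cycle_on S D \<and> set D \<noteq> S \<and>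
    a \<in> carrier R \<and> perm_weight A S p \<otimes> perm_weight A S q
      = (cycle_weight R A C \<otimes> cycle_weight R A D) \<otimes> a"
proof -
  obtain u where u: "p u \<noteq> q u" using ne by (auto simp: fun_eq_iff)
  then have uS: "u \<in> S" using p(1) q(1) by (metis permutes_not_in)
  have pu: "A u (p u) \<in> carrier R" and qu: "A u (q u) \<in> carrier R"
    using A uS permutes_in_image[OF p(1)] permutes_in_image[OF q(1)] by auto
  define P where "P = perm_weight A (S - {u}) p"
  define Q where "Q = perm_weight A (S - {u}) q"
  have PQ: "P \<in> carrier R" "Q \<in> carrier R"
    unfolding P_def Q_def using perm_weight_closed[OF p(1) _ A] perm_weight_closed[OF q(1) _ A] by auto
  obtain C a where C: "nontrivial_cycle_on S C" "set C \<noteq> S" "a \<in> carrier R"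
      "A u (q u) \<otimes> P = cycle_weight R A C \<otimes> a"
    using shortcut_cycle[OF p q fin uS u A] unfolding P_def by blast
  obtain D b where D: "nontrivial_cycle_on S D" "set D \<noteq> S" "b \<in> carrier R"
      "A u (p u) \<otimes> Q = cycle_weight R A D \<otimes> b"
    using shortcut_cycle[OF q p fin uS u[symmetric] A] unfolding Q_def by blast
  have cw: "cycle_weight R A E \<in> carrier R" if "nontrivial_cycle_on S E" for E
    unfolding cycle_weight_def
    using that A by (intro finprod_closed) (auto simp: nontrivial_cycle_on_def is_cycle_on_def subset_iff)
  have "perm_weight A S p \<otimes> perm_weight A S q = (A u (p u) \<otimes> P) \<otimes> (A u (q u) \<otimes> Q)"
    unfolding P_def Q_def
    using perm_weight_split[OF p(1) fin _ order_refl A, of "{u}"]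
      perm_weight_split[OF q(1) fin _ order_refl A, of "{u}"] uS pu qu by simp
  also have "\<dots> = (A u (q u) \<otimes> P) \<otimes> (A u (p u) \<otimes> Q)"
    using pu qu PQ by (simp add: m_ac)
  also have "\<dots> = (cycle_weight R A C \<otimes> cycle_weight R A D) \<otimes> (a \<otimes> b)"
    unfolding C(4) D(4) using C D cw by (simp add: m_ac)
  finally show ?thesis using C D by blast
qed

lemma cycle_weight_eq_perm_weight:
  assumes C: "is_cycle_on S C" and A: "\<forall>i\<in>set C. \<forall>j\<in>set C. A i j \<in> carrier R"
  shows "\<exists>p. p permutes set C \<and> cyclic_on p (set C) \<and> cycle_weight R A C = perm_weight A (set C) p"
proof -
  define p where "p = cycle_of_list C"
  have d: "distinct C" "C \<noteq> []" using C by (auto simp: is_cycle_on_def)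
  have p: "p permutes set C" unfolding p_def by (rule cycle_permutes)
  have rot: "map (p ^^ m) C = rotate m C" for m
    unfolding p_def by (rule cyclic_rotation[OF d(1)])
  have pw: "(p ^^ m) (C ! j) = C ! ((m + j) mod length C)" if "j < length C" for j m
    using arg_cong[OF rot[of m], of "\<lambda>xs. xs ! j"] that by (simp add: nth_rotate)
  have "set C \<subseteq> orbit p (C ! 0)"
  proof
    fix y assume "y \<in> set C"
    then obtain m where m: "m < length C" "C ! m = y" by (auto simp: in_set_conv_nth)
    then have "(p ^^ (m + length C)) (C ! 0) = y" "0 < m + length C"
      using pw[of 0 "m + length C"] d(2) by auto
    then show "y \<in> orbit p (C ! 0)" unfolding orbit_altdef by blast
  qed
  then have "cyclic_on p (set C)"
    using permutes_orbit_subset[OF p, of "C ! 0"] d(2) by (intro cyclic_on_singleI[of "C ! 0"]) auto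
  moreover have "cycle_weight R A C = perm_weight A (set C) p"
  proof -
    have img: "(!) C ` {..<length C} = set C" by (auto simp: set_conv_nth)
    have "cycle_weight R A C = (\<Otimes>j\<in>{..<length C}. A (C ! j) (p (C ! j)))"
      unfolding cycle_weight_def
    proof (rule finprod_cong')
      show "(\<lambda>j. A (C ! j) (p (C ! j))) \<in> {..<length C} \<rightarrow> carrier R"
        using A permutes_in_image[OF p] by auto
      show "A (C ! j) (C ! (Suc j mod length C)) = A (C ! j) (p (C ! j))"
        if "j \<in> {..<length C}" for j
        using pw[of j 1] that by simp
    qed simp
    also have "\<dots> = perm_weight A ((!) C ` {..<length C}) p"
    proof (rule finprod_reindex[symmetric])
      show "(\<lambda>i. A i (p i)) \<in> (!) C ` {..<length C} \<rightarrow> carrier R"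
        unfolding img using A permutes_in_image[OF p] by auto
      show "inj_on ((!) C) {..<length C}" using d(1) by (auto simp: inj_on_nth)
    qed
    finally show ?thesis unfolding img .
  qed
  ultimately show ?thesis using p by blast
qed

lemma sign_multiple:
  fixes p :: "nat \<Rightarrow> nat"
  assumes "x \<in> carrier R"
  shows "[sign p] \<cdot> x = x \<or> [sign p] \<cdot> x = \<ominus> x"
proof -
  have "[(1::int)] \<cdot> x = x"
    using assms by (simp add: add_pow_def int_pow_def nat_pow_def)
  moreover have "[(- 1::int)] \<cdot> x = \<ominus> x"
    using assms by (simp add: add_pow_int_lt)
  ultimately show ?thesis
    by (metis sign_cases)
qed

text \<open>In the Leibniz expansion of the minor, the identity contributes the diagonal product. After
  multiplication by the weight of \<open>p\<close>, all remaining terms except that of \<open>p\<close> lie in \<open>K\<close> up to sign,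
  and the term of \<open>p\<close> is the square up to sign.\<close>

lemma perm_weight_square_mem:
  assumes K: "ideal K R" and fin: "finite S" and p: "p permutes S" "p \<noteq> id"
    and A: "\<forall>i\<in>S. \<forall>j\<in>S. A i j \<in> carrier R"
    and minor: "perm_weight A S p \<otimes> (principal_minor R A S \<ominus> (\<Otimes>i\<in>S. A i i)) \<in> K"
    and other: "\<And>q. q permutes S \<Longrightarrow> q \<noteq> id \<Longrightarrow> q \<noteq> p \<Longrightarrow> perm_weight A S p \<otimes> perm_weight A S q \<in> K"
  shows "perm_weight A S p \<otimes> perm_weight A S p \<in> K"
proof -
  define w where "w = perm_weight A S"
  define t where "t = (\<lambda>q. [sign q] \<cdot> w q)"
  define P where "P = {q. q permutes S}"
  have P: "finite P" "p \<in> P" "id \<in> P"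
    using finite_permutations[OF fin] p permutes_id by (auto simp: P_def)
  have wR: "w q \<in> carrier R" if "q \<in> P" for q
    unfolding w_def using that perm_weight_closed[OF _ order_refl A] by (auto simp: P_def)
  have t: "t q = w q \<or> t q = \<ominus> w q" if "q \<in> P" for q
    using sign_multiple[OF wR[OF that]] by (simp add: t_def)
  then have tR: "t q \<in> carrier R" if "q \<in> P" for q
    using wR[OF that] that by (metis a_inv_closed)
  have tid: "t id = (\<Otimes>i\<in>S. A i i)"
    using wR[OF P(3)] by (simp add: t_def w_def sign_id add_pow_def int_pow_def nat_pow_def)
  define rest where "rest = (\<Oplus>q\<in>P - {id, p}. t q)"
  have restR: "rest \<in> carrier R" unfolding rest_def using tR by (intro finsum_closed) auto
  have "principal_minor R A S = (\<Oplus>q\<in>P. t q)"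
    by (simp add: principal_minor_def P_def t_def w_def)
  also have "P = insert id (insert p (P - {id, p}))" using P by auto
  also have "(\<Oplus>q\<in>\<dots>. t q) = t id \<oplus> (t p \<oplus> rest)"
    unfolding rest_def using P tR p(2) by (subst finsum_insert; (subst finsum_insert)?) auto
  finally have "principal_minor R A S \<ominus> (\<Otimes>i\<in>S. A i i) = t p \<oplus> rest"
    unfolding tid[symmetric] using tR P restR by (simp add: add_minus_cancel)
  then have sum: "w p \<otimes> t p \<oplus> w p \<otimes> rest \<in> K"
    using minor tR wR P restR by (simp add: w_def r_distr)
  have wt: "w p \<otimes> t q \<in> K" if "q \<in> P - {id, p}" for q
  proof -
    have "w p \<otimes> w q \<in> K" using other that by (auto simp: P_def w_def)
    then show ?thesis
      using t[of q] that wR P ideal_mem(4)[OF K] by (auto simp: r_minus)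
  qed
  have "w p \<otimes> rest = (\<Oplus>q\<in>P - {id, p}. w p \<otimes> t q)"
    unfolding rest_def using P tR wR by (intro finsum_rdistr) auto
  also have "\<dots> \<in> K" by (rule finsum_in_ideal[OF K wt])
  finally have rest: "w p \<otimes> rest \<in> K" .
  have "w p \<otimes> t p = (w p \<otimes> t p \<oplus> w p \<otimes> rest) \<ominus> w p \<otimes> rest"
    using tR wR P restR by (simp add: a_minus_def a_assoc r_neg)
  then have "w p \<otimes> t p \<in> K"
    using ideal_mem(5)[OF K sum rest] by simp
  then have "w p \<otimes> w p \<in> K"
    using t[OF P(2)] wR[OF P(2)] ideal_mem(4)[OF K, of "w p \<otimes> t p"] by (auto simp: r_minus)
  then show ?thesis by (simp add: w_def)
qed

section \<open>Adjoining cycle weights one support at a time\<close>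

text \<open>The generators of \<open>J(A)\<close> together with the weights of all nontrivial cycles whose support belongs
  to the family \<open>\<F>\<close>. Enlarging \<open>\<F>\<close> from the empty family to all subsets interpolates between \<open>J(A)\<close>
  and an ideal that contains every nontrivial cycle weight.\<close>

definition staged_generators :: "nat \<Rightarrow> (nat \<Rightarrow> nat \<Rightarrow> 'a) \<Rightarrow> nat set set \<Rightarrow> 'a set" where
  "staged_generators n A \<F> =
     {principal_minor R A S \<ominus> (\<Otimes>i\<in>S. A i i) | S. S \<subseteq> {1..n}} \<union>
     {cycle_weight R A C | C. nontrivial_cycle_on {1..n} C \<and> set C \<in> \<F>}"

lemma cycle_weight_closed:
  assumes "is_cycle_on S C" "\<forall>i\<in>S. \<forall>j\<in>S. A i j \<in> carrier R"
  shows "cycle_weight R A C \<in> carrier R"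
  unfolding cycle_weight_def
proof (rule finprod_closed, rule Pi_I)
  fix j assume "j \<in> {..<length C}"
  then have "C ! j \<in> set C" "C ! (Suc j mod length C) \<in> set C"
    by (auto intro!: nth_mem mod_less_divisor)
  then show "A (C ! j) (C ! (Suc j mod length C)) \<in> carrier R"
    using assms unfolding is_cycle_on_def by blast
qed

lemma minor_closed:
  assumes "\<forall>i\<in>S. \<forall>j\<in>S. A i j \<in> carrier R"
  shows "principal_minor R A S \<ominus> (\<Otimes>i\<in>S. A i i) \<in> carrier R"
proof (rule minus_closed)
  have "perm_weight A S p \<in> carrier R" if "p permutes S" for p
    using perm_weight_closed[OF that order_refl assms] .
  then show "principal_minor R A S \<in> carrier R"
    unfolding principal_minor_def by (intro finsum_closed) auto
  show "(\<Otimes>i\<in>S. A i i) \<in> carrier R"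
    using assms by (intro finprod_closed) auto
qed

context
  fixes n :: nat and A :: "nat \<Rightarrow> nat \<Rightarrow> 'a"
  assumes A: "\<forall>i\<in>{1..n}. \<forall>j\<in>{1..n}. A i j \<in> carrier R"
begin

lemma A_sub: "S \<subseteq> {1..n} \<Longrightarrow> \<forall>i\<in>S. \<forall>j\<in>S. A i j \<in> carrier R"
  using A by blast

lemma staged_generators_carrier: "staged_generators n A \<F> \<subseteq> carrier R"
  using minor_closed[OF A_sub] cycle_weight_closed[OF _ A]
  by (auto simp: staged_generators_def nontrivial_cycle_on_def)

lemma staged_generators_finite: "finite (staged_generators n A \<F>)"
proof -
  have "finite {C :: nat list. set C \<subseteq> {1..n} \<and> distinct C}"
    by (rule finite_subset_distinct) simp
  then have "finite {C. nontrivial_cycle_on {1..n} C \<and> set C \<in> \<F>}"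
    by (rule rev_finite_subset) (auto simp: nontrivial_cycle_on_def is_cycle_on_def)
  moreover have "finite {S. S \<subseteq> {1..n}}" by simp
  ultimately show ?thesis
    unfolding staged_generators_def setcompr_eq_image by blast
qed

lemma staged_ideal: "ideal (Idl (staged_generators n A \<F>)) R"
  by (intro genideal_ideal staged_generators_carrier)

lemma staged_ideal_empty: "Idl (staged_generators n A {}) = minor_ideal R n A"
  by (simp add: staged_generators_def minor_ideal_def)

lemma minor_ideal_is_ideal: "ideal (minor_ideal R n A) R"
  using staged_ideal[of "{}"] unfolding staged_ideal_empty .

lemma staged_ideal_mono:
  assumes "\<F> \<subseteq> \<G>"
  shows "Idl (staged_generators n A \<F>) \<subseteq> Idl (staged_generators n A \<G>)"
  using assms by (intro subset_Idl_subset staged_generators_carrier) (auto simp: staged_generators_def)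

lemma minor_in_staged_ideal:
  assumes "S \<subseteq> {1..n}"
  shows "principal_minor R A S \<ominus> (\<Otimes>i\<in>S. A i i) \<in> Idl (staged_generators n A \<F>)"
  using genideal_self[OF staged_generators_carrier, of \<F>] assms
  by (auto simp: staged_generators_def)

lemma cycle_in_staged_ideal:
  assumes "nontrivial_cycle_on {1..n} C" "set C \<in> \<F>"
  shows "cycle_weight R A C \<in> Idl (staged_generators n A \<F>)"
  using genideal_self[OF staged_generators_carrier, of \<F>] assms
  by (auto simp: staged_generators_def)

text \<open>Two cycles with support \<open>S\<close> that induce different permutations have a product divisible by two
  weights of cycles with strictly smaller support. For two cycles with the same permutation the product is a square,
  which the minor on \<open>S\<close> expresses by the products just treated and by products with weights of
  non-transitive permutations.\<close>

lemma cycle_products_mem: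
  assumes S: "S \<subseteq> {1..n}" and sub: "\<And>T. T \<subset> S \<Longrightarrow> T \<in> \<F>"
    and C: "nontrivial_cycle_on {1..n} C" "set C = S"
    and D: "nontrivial_cycle_on {1..n} D" "set D = S"
  shows "cycle_weight R A C \<otimes> cycle_weight R A D
    \<in> (Idl (staged_generators n A \<F>)) \<cdot> (Idl (staged_generators n A (insert S \<F>)))"
proof -
  define L where "L = Idl (staged_generators n A \<F>)"
  define L' where "L' = Idl (staged_generators n A (insert S \<F>))"
  have L: "ideal L R" and L': "ideal L' R"
    unfolding L_def L'_def by (rule staged_ideal)+
  have LL': "L \<subseteq> L'" unfolding L_def L'_def by (intro staged_ideal_mono) auto
  have K: "ideal (L \<cdot> L') R" by (intro ideal_prod_is_ideal L L')
  have fin: "finite S" using S finite_subset by blast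
  note AS = A_sub[OF S]
  have short: "cycle_weight R A E \<in> L" if "nontrivial_cycle_on S E" "set E \<noteq> S" for E
    unfolding L_def
  proof (rule cycle_in_staged_ideal)
    show "nontrivial_cycle_on {1..n} E"
      using that S by (auto simp: nontrivial_cycle_on_def is_cycle_on_def)
    show "set E \<in> \<F>"
      using that by (intro sub) (auto simp: nontrivial_cycle_on_def is_cycle_on_def)
  qed
  have two: "card S > 1"
    using C by (auto simp: nontrivial_cycle_on_def is_cycle_on_def distinct_card)
  obtain p where p: "p permutes S" "cyclic_on p S" "cycle_weight R A C = perm_weight A S p"
    using cycle_weight_eq_perm_weight[of "{1..n}" C A] C AS by (auto simp: nontrivial_cycle_on_def)
  obtain q where q: "q permutes S" "cyclic_on q S" "cycle_weight R A D = perm_weight A S q"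
    using cycle_weight_eq_perm_weight[of "{1..n}" D A] D AS by (auto simp: nontrivial_cycle_on_def)
  have diff: "perm_weight A S p \<otimes> perm_weight A S r \<in> L \<cdot> L'"
    if r: "r permutes S" "cyclic_on r S" "p \<noteq> r" for r
  proof -
    obtain C1 D1 a where *: "nontrivial_cycle_on S C1" "set C1 \<noteq> S" "nontrivial_cycle_on S D1"
        "set D1 \<noteq> S" "a \<in> carrier R" "perm_weight A S p \<otimes> perm_weight A S r
          = (cycle_weight R A C1 \<otimes> cycle_weight R A D1) \<otimes> a"
      using cyclic_perm_weight_prod[OF p(1,2) r(1,2) fin r(3) AS] by blast
    have "cycle_weight R A C1 \<otimes> cycle_weight R A D1 \<in> L \<cdot> L'"
      using short[OF *(1,2)] short[OF *(3,4)] LL' by (intro ideal_prod.prod) auto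
    then show ?thesis
      unfolding *(6) by (rule ideal_mem(7)[OF K *(5)])
  qed
  have pL': "perm_weight A S p \<in> L'"
    unfolding p(3)[symmetric] L'_def using C by (intro cycle_in_staged_ideal) auto
  have LpK: "perm_weight A S p \<otimes> x \<in> L \<cdot> L'" if "x \<in> L" for x
  proof -
    have "x \<otimes> perm_weight A S p \<in> L \<cdot> L'" using that pL' by (rule ideal_prod.prod)
    then show ?thesis
      using m_comm[OF ideal_mem(1)[OF L that] ideal_mem(1)[OF L' pL']] by simp
  qed
  have "perm_weight A S p \<otimes> perm_weight A S q \<in> L \<cdot> L'"
  proof (cases "p = q")
    case False
    then show ?thesis using diff q by blast
  next
    case True
    have "p \<noteq> id"
    proof
      assume "p = id"
      obtain x where "x \<in> S" using two by fastforce
      then have "S = {x}"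
        using orbit_cyclic_eq3[OF p(2), of x] orbit_eq_singleton_iff[of p x] \<open>p = id\<close> by auto
      then show False using two by simp
    qed
    have "perm_weight A S p \<otimes> perm_weight A S p \<in> L \<cdot> L'"
    proof (rule perm_weight_square_mem[OF K fin p(1) \<open>p \<noteq> id\<close> AS])
      show "perm_weight A S p \<otimes> (principal_minor R A S \<ominus> (\<Otimes>i\<in>S. A i i)) \<in> L \<cdot> L'"
        using minor_in_staged_ideal[OF S] by (intro LpK) (simp add: L_def)
      fix r assume r: "r permutes S" "r \<noteq> id" "r \<noteq> p"
      show "perm_weight A S p \<otimes> perm_weight A S r \<in> L \<cdot> L'"
      proof (cases "cyclic_on r S")
        case True
        then show ?thesis using diff r by blast
      next
        case False
        then obtain E a where "nontrivial_cycle_on S E" "set E \<noteq> S" "a \<in> carrier R"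
            "perm_weight A S r = cycle_weight R A E \<otimes> a"
          using noncyclic_perm_weight[OF r(1,2) False fin AS] by blast
        then have "perm_weight A S r \<in> L"
          using short ideal_mem(7)[OF L] by simp
        then show ?thesis by (rule LpK)
      qed
    qed
    then show ?thesis using True by simp
  qed
  then show ?thesis
    by (simp add: p(3) q(3) L_def L'_def)
qed

lemma staged_ideal_square:
  assumes S: "S \<subseteq> {1..n}" and sub: "\<And>T. T \<subset> S \<Longrightarrow> T \<in> \<F>"
  defines "L \<equiv> Idl (staged_generators n A \<F>)"
    and "L' \<equiv> Idl (staged_generators n A (insert S \<F>))"
  shows "L' \<cdot> L' \<subseteq> L \<cdot> L'"
proof -
  have L: "ideal L R" and L': "ideal L' R"
    unfolding L_def L'_def by (rule staged_ideal)+
  have gL: "staged_generators n A \<F> \<subseteq> L" and gL': "staged_generators n A (insert S \<F>) \<subseteq> L'"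
    unfolding L_def L'_def by (intro genideal_self staged_generators_carrier)+
  have gen: "x \<in> staged_generators n A \<F> \<or>
      (\<exists>C. nontrivial_cycle_on {1..n} C \<and> set C = S \<and> x = cycle_weight R A C)"
    if "x \<in> staged_generators n A (insert S \<F>)" for x
    using that by (auto simp: staged_generators_def)
  have "x \<otimes> y \<in> L \<cdot> L'"
    if x: "x \<in> staged_generators n A (insert S \<F>)" and y: "y \<in> staged_generators n A (insert S \<F>)" for x y
  proof -
    consider "x \<in> L" | "y \<in> L"
      | C D where "nontrivial_cycle_on {1..n} C" "set C = S" "x = cycle_weight R A C"
          "nontrivial_cycle_on {1..n} D" "set D = S" "y = cycle_weight R A D"
      using gen[OF x] gen[OF y] gL by blast
    then show ?thesis
    proof cases
      case 1
      then show ?thesis using y gL' by (intro ideal_prod.prod) auto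
    next
      case 2
      then have "y \<otimes> x \<in> L \<cdot> L'" using x gL' by (intro ideal_prod.prod) auto
      then show ?thesis
        using m_comm[of x y] x y staged_generators_carrier by (metis subsetD)
    next
      case 3
      then show ?thesis
        using cycle_products_mem[OF S sub] unfolding L_def L'_def by blast
    qed
  qed
  then show ?thesis
    using genideal_prod_subsetI[OF staged_generators_carrier staged_generators_carrier
        ideal_prod_is_ideal[OF L L']] unfolding L'_def by blast
qed

text \<open>The supports are adjoined in order of increasing size, so that each new support comes after all of its
  proper subsets. At every step the previous ideal is a reduction of the next one.\<close>

lemma minor_ideal_reduction:
  assumes "finite \<F>" "\<F> \<subseteq> Pow {1..n}" "\<And>S T. S \<in> \<F> \<Longrightarrow> T \<subseteq> S \<Longrightarrow> T \<in> \<F>"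
  shows "\<exists>m. ideal_pow (Idl (staged_generators n A \<F>)) (Suc m)
    \<subseteq> minor_ideal R n A \<cdot> ideal_pow (Idl (staged_generators n A \<F>)) m"
  using assms
proof (induction \<F> rule: finite_ranking_induct[where f = card])
  case empty
  show ?case
    unfolding staged_ideal_empty
    by (intro exI[of _ 0])
       (simp add: ideal_pow_1 ideal_pow_simps(1) ideal_prod_one minor_ideal_is_ideal)
next
  case (insert S \<F>)
  show ?case
  proof (cases "S \<in> \<F>")
    case True
    then show ?thesis using insert by (simp add: insert_absorb)
  next
    case False
    have down: "T \<in> \<F>" if "U \<in> \<F>" "T \<subseteq> U" for T U
    proof -
      have "T \<noteq> S"
      proof
        \<comment> \<open>a proper superset \<open>U\<close> of \<open>S\<close> cannot precede \<open>S\<close> in the order by size\<close>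
        assume "T = S"
        have "finite U" using insert.prems(1) that finite_subset[of U "{1..n}"] by auto
        then have "card U \<le> card S \<Longrightarrow> U = S"
          using card_seteq[of U S] that \<open>T = S\<close> by auto
        then show False using insert.hyps(2)[OF that(1)] that False by simp
      qed
      then show ?thesis using insert.prems(2)[of U T] that by auto
    qed
    obtain m where m: "ideal_pow (Idl (staged_generators n A \<F>)) (Suc m)
        \<subseteq> minor_ideal R n A \<cdot> ideal_pow (Idl (staged_generators n A \<F>)) m"
      using insert.IH insert.prems(1) down by blast
    have "T \<in> \<F>" if "T \<subset> S" for T
      using insert.prems(2)[of S T] that by auto
    then have "(Idl (staged_generators n A (insert S \<F>))) \<cdot> (Idl (staged_generators n A (insert S \<F>)))
        \<subseteq> (Idl (staged_generators n A \<F>)) \<cdot> (Idl (staged_generators n A (insert S \<F>)))"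
      using insert.prems(1) by (intro staged_ideal_square) auto
    then show ?thesis
      using reduction_extend[OF minor_ideal_is_ideal staged_ideal staged_ideal
          staged_ideal_mono[OF subset_insertI] m] by blast
  qed
qed

lemma cycle_weight_integral:
  assumes "nontrivial_cycle_on {1..n} C"
  shows "integral_over_ideal R (minor_ideal R n A) (cycle_weight R A C)"
proof -
  define L where "L = Idl (staged_generators n A (Pow {1..n}))"
  obtain m where "ideal_pow L (Suc m) \<subseteq> minor_ideal R n A \<cdot> ideal_pow L m"
    using minor_ideal_reduction[of "Pow {1..n}"] unfolding L_def by auto
  moreover have "cycle_weight R A C \<in> L"
    unfolding L_def using assms
    by (intro cycle_in_staged_ideal) (auto simp: nontrivial_cycle_on_def is_cycle_on_def)
  ultimately show ?thesis
    using integral_of_reduction[OF minor_ideal_is_ideal staged_generators_finite staged_generators_carrier]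
    unfolding L_def by blast
qed

end

end

theorem theorem4p6:
  fixes R :: "('a, 'b) ring_scheme" and n :: nat and A :: "nat \<Rightarrow> nat \<Rightarrow> 'a"
  assumes "cring R"
    and "\<And>i j. i \<in> {1..n} \<Longrightarrow> j \<in> {1..n} \<Longrightarrow> A i j \<in> carrier R"
  shows "\<forall>C. nontrivial_cycle_on {1..n} C \<longrightarrow>
           integral_over_ideal R (minor_ideal R n A) (cycle_weight R A C) \<and>
           cycle_weight R A C \<in> integral_closure R (minor_ideal R n A)"
proof -
  have "\<forall>i\<in>{1..n}. \<forall>j\<in>{1..n}. A i j \<in> carrier R"
    using assms(2) by blast
  then show ?thesis
    using cring.cycle_weight_integral[OF assms(1)] by (simp add: integral_closure_def)
qed

end
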